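(* Let $(\mathfrak A,\mathfrak M)$ be a Cartan pair with $\mathfrak A$ unital, let $X=\widehat{\mathfrak M}$, and let $x_0\in X$. Then the state $f\in C(X)\mapsto f(x_0)$ of $\mathfrak M=C(X)$ extends to a unique state of $\mathfrak A$ if and only if $x_0$ has trivial isotropy.
   Context: $(\mathfrak A,\mathfrak M)$ is a Cartan pair if $\mathfrak A$ is a separable C$^*$-algebra (here unital), $\mathfrak M$ is a maximal abelian C$^*$-subalgebra of $\mathfrak A$ (containing the unit), $\mathfrak M$ is regular, i.e. the set $\mathcal N$ of normalizers generates $\mathfrak A$ as a C$^*$-algebra, and there is a faithful conditional expectation $E:\mathfrak A\to\mathfrak M$ (it is unique). A normalizer is an element $0\ne n\in\mathfrak A$ with $n^*\mathfrak M n\subset\mathfrak M$ and $n\mathfrak M n^*\subset\mathfrak M$. With $X=\widehat{\mathfrak M}$ the Gelfand space, $\mathfrak M$ is identified with $C(X)$. For $n\in\mathcal N$, $\alpha_n$ denotes the homeomorphism from the open set $\mathrm{dom}(\alpha_n)=\{x\in X: n^*n(x)>0\}$ onto $\{x\in X: nn^*(x)>0\}$ determined by $(n^*hn)(x)=h(\alpha_n(x))\,n^*n(x)$ for $h\in C(X)$. A point $x\in X$ has non-trivial isotropy if there is $n\in\mathcal N$ with $x\in\mathrm{dom}(\alpha_n)$, $\alpha_n(x)=x$ and $E(n)(x)=0$ (equivalently, $\alpha_n(x)=x$ but $\alpha_n$ is not the identity on any neighborhood of $x$); otherwise $x$ has trivial isotropy. *)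

theory Defs
  imports "HOL-Analysis.Analysis"
begin

text \<open>
  A (nonzero) unital C*-algebra is a type of the following class. The superclasses give a complete
  real normed algebra with submultiplicative norm and a unit of norm 1.
\<close>

class unital_cstar_algebra = real_normed_algebra_1 + banach +
  fixes scaleC :: "complex \<Rightarrow> 'a \<Rightarrow> 'a" (infixr "*\<^sub>C" 75)
    and adj :: "'a \<Rightarrow> 'a"
  assumes scaleC_add_right: "c *\<^sub>C (a + b) = c *\<^sub>C a + c *\<^sub>C b"
    and scaleC_add_left: "(c + d) *\<^sub>C a = c *\<^sub>C a + d *\<^sub>C a"
    and scaleC_scaleC: "c *\<^sub>C d *\<^sub>C a = (c * d) *\<^sub>C a"
    and scaleC_of_real: "complex_of_real r *\<^sub>C a = r *\<^sub>R a"
    and mult_scaleC_left: "(c *\<^sub>C a) * b = c *\<^sub>C (a * b)"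
    and mult_scaleC_right: "a * (c *\<^sub>C b) = c *\<^sub>C (a * b)"
    and norm_scaleC: "norm (c *\<^sub>C a) = cmod c * norm a"
    and adj_adj: "adj (adj a) = a"
    and adj_add: "adj (a + b) = adj a + adj b"
    and adj_scaleC: "adj (c *\<^sub>C a) = cnj c *\<^sub>C adj a"
    and adj_mult: "adj (a * b) = adj b * adj a"
    and cstar_identity: "norm (adj a * a) = (norm a)\<^sup>2"

instantiation complex :: unital_cstar_algebra
begin

definition scaleC_complex :: "complex \<Rightarrow> complex \<Rightarrow> complex" where
  "scaleC_complex c z = c * z"

definition adj_complex :: "complex \<Rightarrow> complex" where
  "adj_complex z = cnj z"

instance
  by standard
    (simp_all add: scaleC_complex_def adj_complex_def algebra_simps norm_mult
      scaleR_conv_of_real power2_eq_square)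

end

definition clinear_on ::
    "'a::unital_cstar_algebra set \<Rightarrow> ('a \<Rightarrow> 'b::unital_cstar_algebra) \<Rightarrow> bool" where
  "clinear_on S f \<longleftrightarrow>
     (\<forall>a\<in>S. \<forall>b\<in>S. f (a + b) = f a + f b) \<and> (\<forall>c. \<forall>a\<in>S. f (c *\<^sub>C a) = c *\<^sub>C f a)"

definition cstar_subalgebra :: "'a::unital_cstar_algebra set \<Rightarrow> bool" where
  "cstar_subalgebra B \<longleftrightarrow>
     0 \<in> B \<and>
     (\<forall>a\<in>B. \<forall>b\<in>B. a + b \<in> B) \<and>
     (\<forall>c. \<forall>a\<in>B. c *\<^sub>C a \<in> B) \<and>
     (\<forall>a\<in>B. \<forall>b\<in>B. a * b \<in> B) \<and>
     (\<forall>a\<in>B. adj a \<in> B) \<and>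
     closed B"

definition abelian_cstar_subalgebra :: "'a::unital_cstar_algebra set \<Rightarrow> bool" where
  "abelian_cstar_subalgebra B \<longleftrightarrow> cstar_subalgebra B \<and> (\<forall>a\<in>B. \<forall>b\<in>B. a * b = b * a)"

definition maximal_abelian :: "'a::unital_cstar_algebra set \<Rightarrow> bool" where
  "maximal_abelian M \<longleftrightarrow>
     abelian_cstar_subalgebra M \<and> (\<forall>B. abelian_cstar_subalgebra B \<and> M \<subseteq> B \<longrightarrow> B = M)"

definition positive_elements :: "'a::unital_cstar_algebra set \<Rightarrow> 'a set" where
  "positive_elements B = {adj b * b |b. b \<in> B}"

text \<open>The order on \<^typ>\<open>complex\<close> makes \<open>0 \<le> z\<close> mean that \<open>z\<close> is real and nonnegative.\<close>

definition is_state :: "('a::unital_cstar_algebra \<Rightarrow> complex) \<Rightarrow> bool" where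
  "is_state \<phi> \<longleftrightarrow> clinear_on UNIV \<phi> \<and> (\<forall>a\<in>positive_elements UNIV. 0 \<le> \<phi> a) \<and> \<phi> 1 = 1"

definition normalizers :: "'a::unital_cstar_algebra set \<Rightarrow> 'a set" where
  "normalizers M =
     {n. n \<noteq> 0 \<and> (\<forall>h\<in>M. adj n * h * n \<in> M) \<and> (\<forall>h\<in>M. n * h * adj n \<in> M)}"

definition conditional_expectation ::
    "'a::unital_cstar_algebra set \<Rightarrow> ('a \<Rightarrow> 'a) \<Rightarrow> bool" where
  "conditional_expectation M E \<longleftrightarrow>
     clinear_on UNIV E \<and>
     range E \<subseteq> M \<and>
     (\<forall>h\<in>M. E h = h) \<and>
     (\<forall>a. norm (E a) \<le> norm a) \<and>
     E ` positive_elements UNIV \<subseteq> positive_elements M \<and>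
     (\<forall>h\<in>M. \<forall>k\<in>M. \<forall>a. E (h * a * k) = h * E a * k)"

definition faithful_conditional_expectation ::
    "'a::unital_cstar_algebra set \<Rightarrow> ('a \<Rightarrow> 'a) \<Rightarrow> bool" where
  "faithful_conditional_expectation M E \<longleftrightarrow>
     conditional_expectation M E \<and> (\<forall>a\<in>positive_elements UNIV. E a = 0 \<longrightarrow> a = 0)"

text \<open>The ambient C*-algebra is the whole type \<^typ>\<open>'a\<close>.\<close>

definition cartan_pair :: "'a::unital_cstar_algebra set \<Rightarrow> bool" where
  "cartan_pair M \<longleftrightarrow>
     separable_space (euclidean :: 'a topology) \<and>
     maximal_abelian M \<and>
     1 \<in> M \<and>
     cstar_subalgebra hull normalizers M = UNIV \<and>
     (\<exists>E. faithful_conditional_expectation M E)"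

text \<open>
  Points of the Gelfand space are characters of \<open>M\<close>, made extensional so that equality of points
  is equality of functions. Under the identification of \<open>M\<close> with the continuous functions on its
  Gelfand space, the value of \<open>h \<in> M\<close> at the point \<open>x\<close> is \<open>x h\<close>.
\<close>

definition gelfand_space :: "'a::unital_cstar_algebra set \<Rightarrow> ('a \<Rightarrow> complex) set" where
  "gelfand_space M =
     {x \<in> extensional M. clinear_on M x \<and> (\<forall>h\<in>M. \<forall>k\<in>M. x (h * k) = x h * x k) \<and>
        (\<exists>h\<in>M. x h \<noteq> 0)}"

definition alpha_dom ::
    "'a::unital_cstar_algebra set \<Rightarrow> 'a \<Rightarrow> ('a \<Rightarrow> complex) set" where
  "alpha_dom M n = {x \<in> gelfand_space M. 0 < x (adj n * n)}"

text \<open>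
  For a normalizer \<open>n\<close>, \<open>alpha M n x\<close> is only meaningful for \<open>x \<in> alpha_dom M n\<close>, where the
  condition below determines a unique point.
\<close>

definition alpha ::
    "'a::unital_cstar_algebra set \<Rightarrow> 'a \<Rightarrow> ('a \<Rightarrow> complex) \<Rightarrow> ('a \<Rightarrow> complex)" where
  "alpha M n x =
     (THE y. y \<in> gelfand_space M \<and> (\<forall>h\<in>M. x (adj n * h * n) = y h * x (adj n * n)))"

definition nontrivial_isotropy ::
    "'a::unital_cstar_algebra set \<Rightarrow> ('a \<Rightarrow> 'a) \<Rightarrow> ('a \<Rightarrow> complex) \<Rightarrow> bool" where
  "nontrivial_isotropy M E x \<longleftrightarrow>
     (\<exists>n\<in>normalizers M. x \<in> alpha_dom M n \<and> alpha M n x = x \<and> x (E n) = 0)"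

abbreviation trivial_isotropy ::
    "'a::unital_cstar_algebra set \<Rightarrow> ('a \<Rightarrow> 'a) \<Rightarrow> ('a \<Rightarrow> complex) \<Rightarrow> bool" where
  "trivial_isotropy M E x \<equiv> \<not> nontrivial_isotropy M E x"

end

theory Submission
  imports Defs
begin

text \<open>
  Composing \<open>x\<^sub>0\<close> with the conditional expectation gives one state \<open>\<psi> = x\<^sub>0 \<circ> E\<close> that extends the
  character \<open>x\<^sub>0\<close>; the question is whether there is another. Throughout, a state \<open>\<phi>\<close> that extends a
  character has \<open>M\<close> in its multiplicative domain: by the Cauchy-Schwarz inequality
  \<open>\<phi> (h * a) = x\<^sub>0 h * \<phi> a = \<phi> (a * h)\<close> for \<open>h \<in> M\<close> (\<open>state_extending_character_mult\<close>).

  Suppose that a normalizer \<open>n\<close> fixes \<open>x\<^sub>0\<close> and that \<open>\<psi> n = 0\<close>. In the GNS representation of \<open>\<psi>\<close> with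
  cyclic vector \<open>\<Omega>\<close>, the vectors \<open>\<Omega>\<close> and \<open>n \<Omega>\<close> are then orthogonal eigenvectors of \<open>M\<close> for the
  same character \<open>x\<^sub>0\<close>, so every vector state of their span extends \<open>x\<^sub>0\<close>. The vectors \<open>\<Omega> + n \<Omega>\<close>
  and \<open>\<Omega> + \<i> n \<Omega>\<close> cannot both give \<open>n\<close> the value \<open>0\<close>, hence one of them gives a state
  different from \<open>\<psi>\<close> (\<open>nontrivial_isotropy_second_state\<close>). Written out algebraically, the state is
  \<open>a \<mapsto> \<psi> (adj (1 + c n) * a * (1 + c n))\<close> up to normalization, and no representation is needed.

  Conversely, let \<open>x\<^sub>0\<close> have trivial isotropy and let \<open>\<phi>\<close> be any extension. A normalizer falls into
  one of three cases (\<open>extension_at_normalizer\<close>). If \<open>n\<close> is not defined at \<open>x\<^sub>0\<close>, then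
  \<open>\<phi> (adj n * n) = 0\<close> forces \<open>\<phi> n = 0\<close>. If \<open>n\<close> moves \<open>x\<^sub>0\<close>, some \<open>h \<in> M\<close> takes different values at
  \<open>x\<^sub>0\<close> and at its image, and evaluating \<open>h * n * (adj n * n) = n * (adj n * h * n)\<close> with the
  multiplicative domain again forces \<open>\<phi> n = 0\<close>. In the remaining case \<open>x\<^sub>0 (E n) \<noteq> 0\<close>. Here
  \<open>n * adj (E n)\<close> commutes with \<open>M\<close>, because \<open>n\<close> acts trivially wherever \<open>E n\<close> does not vanish; by
  maximality it lies in \<open>M\<close> (\<open>normalizer_mult_adj_expectation_mem\<close>), so \<open>\<phi>\<close> and \<open>\<psi>\<close> agree on it, and
  the factor \<open>adj (E n)\<close> can be cancelled. Thus all extensions agree on normalizers. States are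
  contractive and normalizers span a dense subspace, so all extensions agree everywhere.
\<close>

section \<open>The involution and complex scalars\<close>

lemma scaleC_one [simp]: "1 *\<^sub>C (a::'a::unital_cstar_algebra) = a"
  using scaleC_of_real[of 1 a] by simp

lemma scaleC_zero_left [simp]: "0 *\<^sub>C (a::'a::unital_cstar_algebra) = 0"
  using scaleC_of_real[of 0 a] by simp

lemma scaleC_zero_right [simp]: "c *\<^sub>C (0::'a::unital_cstar_algebra) = 0"
  using scaleC_add_right[of c 0 "0::'a"] by simp

lemma scaleC_minus_left: "(- c) *\<^sub>C a = - (c *\<^sub>C (a::'a::unital_cstar_algebra))"
  using scaleC_add_left[of c "- c" a] by (simp add: eq_neg_iff_add_eq_0 add.commute)

lemma scaleC_minus_one: "(- 1) *\<^sub>C (a::'a::unital_cstar_algebra) = - a"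
  using scaleC_of_real[of "-1" a] by simp

lemma scaleC_minus_right: "c *\<^sub>C (- a) = - (c *\<^sub>C (a::'a::unital_cstar_algebra))"
  using scaleC_add_right[of c a "- a"] by (simp add: eq_neg_iff_add_eq_0 add.commute)

lemma scaleC_diff_right: "c *\<^sub>C (a - b) = c *\<^sub>C a - c *\<^sub>C (b::'a::unital_cstar_algebra)"
  using scaleC_add_right[of c a "- b"] by (simp add: scaleC_minus_right)

lemma adj_0 [simp]: "adj (0::'a::unital_cstar_algebra) = 0"
  using adj_add[of 0 "0::'a"] by simp

lemma adj_1 [simp]: "adj (1::'a::unital_cstar_algebra) = 1"
  using adj_mult[of "adj 1" "1::'a"] by (simp add: adj_adj)

lemma adj_minus: "adj (- a) = - adj (a::'a::unital_cstar_algebra)"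
  using adj_add[of a "- a"] by (simp add: eq_neg_iff_add_eq_0 add.commute)

lemma adj_diff: "adj (a - b) = adj a - adj (b::'a::unital_cstar_algebra)"
  using adj_add[of a "- b"] by (simp add: adj_minus)

lemma adj_scaleR: "adj (r *\<^sub>R a) = r *\<^sub>R adj (a::'a::unital_cstar_algebra)"
  using adj_scaleC[of "complex_of_real r" a] by (simp add: scaleC_of_real)

lemma adj_power: "adj (a ^ k) = adj (a::'a::unital_cstar_algebra) ^ k"
  by (induction k) (simp_all add: adj_mult power_commutes)

text \<open>
  The C*-identity together with submultiplicativity gives \<open>norm b \<le> norm (adj b)\<close>, and the involution
  exchanges the two sides.
\<close>

lemma norm_adj: "norm (adj a) = norm (a::'a::unital_cstar_algebra)"
proof -
  have le: "norm b \<le> norm (adj b)" for b :: 'a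
  proof (cases "b = 0")
    case False
    have "norm b * norm b \<le> norm (adj b) * norm b"
      using norm_mult_ineq[of "adj b" b] by (simp add: cstar_identity power2_eq_square)
    with False show ?thesis by simp
  qed simp
  show ?thesis using le[of a] le[of "adj a"] by (simp add: adj_adj)
qed

lemma bounded_linear_adj: "bounded_linear (adj :: 'a::unital_cstar_algebra \<Rightarrow> 'a)"
  by (rule bounded_linear_intro[where K = 1]) (simp_all add: adj_add adj_scaleR norm_adj)

lemma bounded_linear_scaleC: "bounded_linear (\<lambda>a::'a::unital_cstar_algebra. c *\<^sub>C a)"
proof (rule bounded_linear_intro[where K = "cmod c"])
  fix r :: real and a :: 'a
  show "c *\<^sub>C (r *\<^sub>R a) = r *\<^sub>R (c *\<^sub>C a)"
    by (simp add: scaleC_of_real[symmetric] scaleC_scaleC mult.commute)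
qed (simp_all add: scaleC_add_right norm_scaleC mult.commute)

lemma adj_mult_self_eq_0_iff: "adj a * a = 0 \<longleftrightarrow> (a::'a::unital_cstar_algebra) = 0"
  using cstar_identity[of a] by auto

section \<open>Positive functionals\<close>

definition positive_functional :: "('a::unital_cstar_algebra \<Rightarrow> complex) \<Rightarrow> bool" where
  "positive_functional \<phi> \<longleftrightarrow> clinear_on UNIV \<phi> \<and> (\<forall>a. 0 \<le> \<phi> (adj a * a))"

lemma is_state_iff: "is_state \<phi> \<longleftrightarrow> positive_functional \<phi> \<and> \<phi> 1 = 1"
  by (auto simp: is_state_def positive_functional_def positive_elements_def)

lemma clinear_UNIV_simps:
  assumes "clinear_on UNIV (\<phi> :: 'a::unital_cstar_algebra \<Rightarrow> complex)"
  shows "\<phi> (a + b) = \<phi> a + \<phi> b" "\<phi> (c *\<^sub>C a) = c * \<phi> a" "\<phi> 0 = 0"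
    "\<phi> (- a) = - \<phi> a" "\<phi> (a - b) = \<phi> a - \<phi> b" "\<phi> (r *\<^sub>R a) = of_real r * \<phi> a"
proof -
  show add: "\<phi> (a + b) = \<phi> a + \<phi> b" for a b
    using assms by (simp add: clinear_on_def)
  show scale: "\<phi> (c *\<^sub>C a) = c * \<phi> a" for c a
    using assms by (simp add: clinear_on_def scaleC_complex_def)
  show "\<phi> 0 = 0" using scale[of 0 0] by simp
  show minus: "\<phi> (- a) = - \<phi> a" for a using scale[of "-1" a] by (simp add: scaleC_minus_one)
  show "\<phi> (a - b) = \<phi> a - \<phi> b" using add[of a "- b"] minus[of b] by simp
  show "\<phi> (r *\<^sub>R a) = of_real r * \<phi> a"
    using scale[of "of_real r" a] by (simp add: scaleC_of_real)
qed

lemma positive_functional_simps: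
  assumes "positive_functional \<phi>"
  shows "\<phi> (a + b) = \<phi> a + \<phi> b" "\<phi> (c *\<^sub>C a) = c * \<phi> a" "\<phi> 0 = 0"
    "\<phi> (- a) = - \<phi> a" "\<phi> (a - b) = \<phi> a - \<phi> b" "\<phi> (r *\<^sub>R a) = of_real r * \<phi> a"
  by (rule clinear_UNIV_simps, use assms in \<open>simp add: positive_functional_def\<close>)+

lemma positive_functional_nonneg: "positive_functional \<phi> \<Longrightarrow> 0 \<le> \<phi> (adj a * a)"
  by (simp add: positive_functional_def)

lemma adj_mult_self_add_scaleC:
  fixes a b :: "'a::unital_cstar_algebra"
  shows "adj (a + c *\<^sub>C b) * (a + c *\<^sub>C b) =
    adj a * a + c *\<^sub>C (adj a * b) + cnj c *\<^sub>C (adj b * a) + (c * cnj c) *\<^sub>C (adj b * b)"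
  by (simp add: adj_add adj_scaleC distrib_left distrib_right mult_scaleC_left mult_scaleC_right
      scaleC_scaleC scaleC_add_right algebra_simps)

text \<open>
  Polarization against the unit: \<open>\<phi>\<close> is real at \<open>adj (a + c 1) * (a + c 1)\<close>, and the choices
  \<open>c = 1\<close> and \<open>c = \<i>\<close> separate the imaginary and the real parts.
\<close>

lemma positive_functional_hermitian:
  assumes \<phi>: "positive_functional \<phi>"
  shows "\<phi> (adj a) = cnj (\<phi> a)"
proof -
  note [simp] = positive_functional_simps[OF \<phi>]
  have nonneg: "0 \<le> \<phi> (adj b * b)" for b
    by (rule positive_functional_nonneg[OF \<phi>])
  have real: "Im (c * \<phi> (adj a) + cnj c * \<phi> a) = 0" for c
  proof -
    have "0 \<le> \<phi> (adj a * a) + c * \<phi> (adj a) + cnj c * \<phi> a + c * cnj c * \<phi> 1"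
      using nonneg[of "a + c *\<^sub>C 1"] by (simp add: adj_mult_self_add_scaleC)
    moreover have "Im (\<phi> (adj a * a)) = 0" "Im (\<phi> 1) = 0"
      using nonneg[of a] nonneg[of 1] by (simp_all add: less_eq_complex_def)
    ultimately show ?thesis by (simp add: less_eq_complex_def)
  qed
  show ?thesis using real[of 1] real[of \<i>] by (simp add: complex_eq_iff)
qed

lemma positive_functional_Cauchy_Schwarz:
  assumes \<phi>: "positive_functional \<phi>"
  shows "(cmod (\<phi> (adj b * a)))\<^sup>2 \<le> Re (\<phi> (adj b * b)) * Re (\<phi> (adj a * a))"
proof -
  note [simp] = positive_functional_simps[OF \<phi>]
  define z where "z = \<phi> (adj b * a)"
  define A where "A = Re (\<phi> (adj a * a))"
  define B where "B = Re (\<phi> (adj b * b))"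
  have ab: "\<phi> (adj a * b) = cnj z"
    using positive_functional_hermitian[OF \<phi>, of "adj b * a"] by (simp add: z_def adj_mult adj_adj)
  have B: "0 \<le> B"
    using positive_functional_nonneg[OF \<phi>, of b] by (simp add: B_def less_eq_complex_def)
  \<comment> \<open>For \<open>c = - t z\<close> with \<open>t > 0\<close> the mixed terms are real and as negative as possible.\<close>
  have quad: "0 \<le> A - 2 * t * (cmod z)\<^sup>2 + t\<^sup>2 * (cmod z)\<^sup>2 * B" for t
  proof -
    have "0 \<le> Re (\<phi> (adj (a + (of_real (- t) * z) *\<^sub>C b) * (a + (of_real (- t) * z) *\<^sub>C b)))"
      using positive_functional_nonneg[OF \<phi>] by (simp add: less_eq_complex_def)
    moreover have "Im (\<phi> (adj b * b)) = 0"
      using positive_functional_nonneg[OF \<phi>, of b] by (simp add: less_eq_complex_def)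
    moreover have "(cmod z)\<^sup>2 = Re z * Re z + Im z * Im z"
      unfolding cmod_power2 by (simp add: power2_eq_square)
    ultimately show ?thesis
      unfolding adj_mult_self_add_scaleC
      by (simp add: ab z_def[symmetric] A_def[symmetric] B_def[symmetric]
          algebra_simps power2_eq_square[of t])
  qed
  have "(cmod z)\<^sup>2 \<le> B * A"
  proof (cases "B = 0")
    case True
    have "(cmod z)\<^sup>2 = 0"
    proof (rule ccontr)
      assume nz: "(cmod z)\<^sup>2 \<noteq> 0"
      have "2 * ((\<bar>A\<bar> + 1) / (cmod z)\<^sup>2) * (cmod z)\<^sup>2 = 2 * (\<bar>A\<bar> + 1)"
        using nz by simp
      then show False using quad[of "(\<bar>A\<bar> + 1) / (cmod z)\<^sup>2"] True by simp
    qed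
    then show ?thesis using True by simp
  next
    case False
    have "0 \<le> A - (cmod z)\<^sup>2 / B"
      using quad[of "1 / B"] False by (simp add: field_simps power2_eq_square)
    then show ?thesis using B False by (simp add: field_simps)
  qed
  then show ?thesis by (simp add: z_def A_def B_def)
qed

lemma positive_functional_mult_eq_0:
  assumes \<phi>: "positive_functional \<phi>" and 0: "\<phi> (adj b * b) = 0"
  shows "\<phi> (adj b * a) = 0" "\<phi> (a * b) = 0"
proof -
  show left: "\<phi> (adj b * a) = 0" for a
    using positive_functional_Cauchy_Schwarz[OF \<phi>, of b a] 0 by simp
  show "\<phi> (a * b) = 0"
    using positive_functional_hermitian[OF \<phi>, of "adj b * adj a"] left[of "adj a"]
    by (simp add: adj_mult adj_adj)
qed

text \<open>
  The binomial series of \<open>sqrt (1 - t)\<close> converges absolutely for \<open>\<bar>t\<bar> < 1\<close>, and by the Vandermonde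
  identity its Cauchy square is the series of \<open>(1 - t) ^ 1\<close>. This is how norm estimates turn into
  positivity: \<open>1 - s\<close> has the form \<open>adj b * b\<close>.
\<close>

lemma sqrt_one_minus_exists:
  fixes s :: "'a::unital_cstar_algebra"
  assumes "norm s < 1" and s: "adj s = s"
  obtains b where "adj b = b" and "b * b = 1 - s"
proof -
  define f where "f k = ((1/2::real) gchoose k) *\<^sub>R (- s) ^ k" for k
  have "summable (\<lambda>k. norm (((1/2::real) gchoose k) * norm s ^ k))"
  proof (rule powser_insidea)
    show "norm (norm s) < norm ((1 + norm s) / 2)" using assms by simp
    show "summable (\<lambda>k. ((1/2::real) gchoose k) * ((1 + norm s) / 2) ^ k)"
      using assms by (intro sums_summable[OF gen_binomial_real]) auto
  qed
  then have sf: "summable (\<lambda>k. norm (f k))"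
  proof (rule summable_comparison_test[rotated], intro exI allI impI)
    fix k
    show "norm (norm (f k)) \<le> norm (((1/2::real) gchoose k) * norm s ^ k)"
      using norm_power_ineq[of "- s" k]
      by (simp add: f_def abs_mult mult_left_mono)
  qed
  define b where "b = (\<Sum>k. f k)"
  have "adj (f k) = f k" for k
    by (simp add: f_def adj_scaleR adj_power adj_minus s)
  then have adj: "adj b = b"
    using bounded_linear.suminf[OF bounded_linear_adj summable_norm_cancel[OF sf]]
    by (simp add: b_def)
  have coeff: "(\<Sum>i\<le>k. f i * f (k - i)) = ((1::real) gchoose k) *\<^sub>R (- s) ^ k" for k
  proof -
    have "(\<Sum>i\<le>k. f i * f (k - i)) =
        (\<Sum>i\<le>k. (((1/2::real) gchoose i) * ((1/2) gchoose (k - i))) *\<^sub>R (- s) ^ k)"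
      by (rule sum.cong) (auto simp: f_def power_add[symmetric])
    also have "\<dots> = ((1::real) gchoose k) *\<^sub>R (- s) ^ k"
      using gbinomial_Vandermonde[of "1/2::real" "1/2" k]
      by (simp add: scaleR_sum_left[symmetric] atLeast0AtMost)
    finally show ?thesis .
  qed
  have "b * b = (\<Sum>k. ((1::real) gchoose k) *\<^sub>R (- s) ^ k)"
    unfolding b_def Cauchy_product[OF sf sf] coeff ..
  \<comment> \<open>The binomial coefficients of exponent \<open>1\<close> vanish from degree \<open>2\<close> on.\<close>
  also have "\<dots> = (\<Sum>k\<le>1. ((1::real) gchoose k) *\<^sub>R (- s) ^ k)"
  proof (rule suminf_finite)
    fix k :: nat assume "k \<notin> {..1}"
    then have "1 choose k = 0" by (simp add: binomial_eq_0)
    then have "(1::real) gchoose k = 0"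
      by (metis binomial_gbinomial of_nat_0 of_nat_1)
    then show "((1::real) gchoose k) *\<^sub>R (- s) ^ k = 0" by simp
  qed simp
  also have "\<dots> = 1 - s" by simp
  finally show thesis using that adj by blast
qed

text \<open>
  For \<open>t > norm s\<close>, where \<open>s = adj a * a\<close>, the element \<open>1 - s / t\<close> has a self-adjoint square root, so
  positivity gives \<open>\<phi> s \<le> t\<close>; the Cauchy-Schwarz inequality passes from \<open>s\<close> to \<open>a\<close>.
\<close>

lemma state_norm_le:
  assumes "is_state \<phi>"
  shows "cmod (\<phi> a) \<le> norm a"
proof -
  have \<phi>: "positive_functional \<phi>" and one: "\<phi> 1 = 1"
    using assms by (simp_all add: is_state_iff)
  note [simp] = positive_functional_simps[OF \<phi>]
  define s where "s = adj a * a"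
  have adj_s: "adj s = s" by (simp add: s_def adj_mult adj_adj)
  have "Re (\<phi> s) \<le> norm s"
  proof (rule dense_ge)
    fix t assume t: "norm s < t"
    then have "0 < t" by (meson norm_ge_zero order.strict_trans1)
    obtain b where b: "adj b = b" "b * b = 1 - (1 / t) *\<^sub>R s"
    proof (rule sqrt_one_minus_exists)
      show "norm ((1 / t) *\<^sub>R s) < 1" using t \<open>0 < t\<close> by simp
      show "adj ((1 / t) *\<^sub>R s) = (1 / t) *\<^sub>R s" by (simp add: adj_scaleR adj_s)
    qed
    have "0 \<le> Re (1 - of_real (1 / t) * \<phi> s)"
      using positive_functional_nonneg[OF \<phi>, of b] b one by (simp add: less_eq_complex_def)
    then show "Re (\<phi> s) \<le> t" using \<open>0 < t\<close> by (simp add: field_simps)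
  qed
  moreover have "(cmod (\<phi> a))\<^sup>2 \<le> Re (\<phi> s)"
    using positive_functional_Cauchy_Schwarz[OF \<phi>, of 1 a] one by (simp add: s_def)
  ultimately have "(cmod (\<phi> a))\<^sup>2 \<le> norm s" by linarith
  also have "norm s = (norm a)\<^sup>2" by (simp add: s_def cstar_identity)
  finally show ?thesis by (rule power2_le_imp_le) simp
qed

lemma state_bounded_linear: "is_state \<phi> \<Longrightarrow> bounded_linear \<phi>"
  using state_norm_le[of \<phi>] positive_functional_simps[of \<phi>]
  by (intro bounded_linear_intro[where K = 1]) (simp_all add: is_state_iff scaleR_conv_of_real)

section \<open>Characters\<close>

lemma cstar_subalgebra_closed:
  assumes "cstar_subalgebra M"
  shows "0 \<in> M" "a \<in> M \<Longrightarrow> b \<in> M \<Longrightarrow> a + b \<in> M" "a \<in> M \<Longrightarrow> c *\<^sub>C a \<in> M"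
    "a \<in> M \<Longrightarrow> b \<in> M \<Longrightarrow> a * b \<in> M" "a \<in> M \<Longrightarrow> adj a \<in> M"
    "a \<in> M \<Longrightarrow> - a \<in> M" "a \<in> M \<Longrightarrow> b \<in> M \<Longrightarrow> a - b \<in> M"
proof -
  show add: "a + b \<in> M" if "a \<in> M" "b \<in> M" for a b
    using assms that by (simp add: cstar_subalgebra_def)
  show minus: "- a \<in> M" if "a \<in> M" for a
  proof -
    have "(- 1) *\<^sub>C a \<in> M" using assms that unfolding cstar_subalgebra_def by blast
    then show ?thesis by (simp add: scaleC_minus_one)
  qed
  show "a - b \<in> M" if "a \<in> M" "b \<in> M" using add[of a "- b"] minus that by simp
qed (use assms in \<open>simp_all add: cstar_subalgebra_def\<close>)

lemma gelfand_space_simps: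
  assumes "x \<in> gelfand_space M" and M: "cstar_subalgebra M"
  shows "h \<in> M \<Longrightarrow> k \<in> M \<Longrightarrow> x (h + k) = x h + x k"
    and "h \<in> M \<Longrightarrow> x (c *\<^sub>C h) = c * x h"
    and "h \<in> M \<Longrightarrow> k \<in> M \<Longrightarrow> x (h * k) = x h * x k"
    and "1 \<in> M \<Longrightarrow> x 1 = 1"
    and "x 0 = 0"
proof -
  show mult: "x (h * k) = x h * x k" if "h \<in> M" "k \<in> M" for h k
    using assms that by (simp add: gelfand_space_def)
  show scale: "x (c *\<^sub>C h) = c * x h" if "h \<in> M" for c h
    using assms that by (simp add: gelfand_space_def clinear_on_def scaleC_complex_def)
  show "x 1 = 1" if "1 \<in> M"
  proof -
    obtain h where "h \<in> M" "x h \<noteq> 0" using assms by (auto simp: gelfand_space_def)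
    then show ?thesis using mult[of 1 h] that by simp
  qed
  show "x 0 = 0" using scale[of 0 0] cstar_subalgebra_closed(1)[OF M] by simp
qed (use assms in \<open>simp add: gelfand_space_def clinear_on_def\<close>)

lemma geometric_series_mem:
  assumes M: "cstar_subalgebra M" "1 \<in> M" and h: "h \<in> M" "norm h < 1"
  shows "(\<Sum>k. h ^ k) \<in> M"
proof -
  note cl = cstar_subalgebra_closed[OF M(1)]
  have pow: "h ^ k \<in> M" for k
    by (induction k) (use M h cl in simp_all)
  show ?thesis
  proof (rule closed_sequentially)
    show "closed M" using M(1) by (simp add: cstar_subalgebra_def)
    show "(\<Sum>k<n. h ^ k) \<in> M" for n
      by (induction n) (use pow cl in simp_all)
    show "(\<lambda>n. \<Sum>k<n. h ^ k) \<longlonglongrightarrow> (\<Sum>k. h ^ k)"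
      using h complete_algebra_summable_geometric summable_LIMSEQ by blast
  qed
qed

text \<open>
  If \<open>\<bar>x h\<bar> > norm h\<close>, scale \<open>h\<close> to \<open>k\<close> with \<open>norm k < 1\<close> and \<open>x k = 1\<close>. The geometric series
  \<open>g\<close> of \<open>k\<close> satisfies \<open>g = 1 + k * g\<close>, which \<open>x\<close> maps to \<open>x g = 1 + x g\<close>.
\<close>

lemma character_norm_le:
  assumes x: "x \<in> gelfand_space M" and M: "cstar_subalgebra M" "1 \<in> M" and h: "h \<in> M"
  shows "cmod (x h) \<le> norm h"
proof (rule ccontr)
  note cl = cstar_subalgebra_closed[OF M(1)] and xs = gelfand_space_simps[OF x M(1)]
  assume "\<not> cmod (x h) \<le> norm h"
  then have less: "norm h < cmod (x h)" by simp
  then have nz: "x h \<noteq> 0" using norm_ge_zero[of h] by (metis norm_zero not_le)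
  define k where "k = (1 / x h) *\<^sub>C h"
  have k: "k \<in> M" "norm k < 1" "x k = 1"
    using h less nz xs(2)[OF h] cl(3)
    by (simp_all add: k_def norm_scaleC norm_divide)
  define g where "g = (\<Sum>i. k ^ i)"
  have g: "g \<in> M" unfolding g_def by (rule geometric_series_mem[OF M k(1,2)])
  have "summable (\<lambda>i. k ^ i)" by (rule complete_algebra_summable_geometric[OF k(2)])
  then have "g = 1 + k * g"
    using suminf_split_head[of "\<lambda>i. k ^ i"] by (simp add: g_def suminf_mult)
  then have "x g = 1 + x g"
    using xs(1)[of 1 "k * g"] xs(3)[of k g] xs(4) cl(4)[of k g] M k g by simp
  then show False by simp
qed

text \<open>
  Shift by imaginary scalars: \<open>\<bar>x (h + \<i> t)\<bar>\<^sup>2\<close> contains the term \<open>2 t Im (x h)\<close>, which is unbounded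
  in \<open>t\<close> in both directions, while the C*-identity bounds it by \<open>(norm h)\<^sup>2 + t\<^sup>2\<close>.
\<close>

lemma character_self_adjoint_real:
  assumes x: "x \<in> gelfand_space M" and M: "cstar_subalgebra M" "1 \<in> M"
    and h: "h \<in> M" "adj h = h"
  shows "Im (x h) = 0"
proof (rule ccontr)
  note cl = cstar_subalgebra_closed[OF M(1)] and xs = gelfand_space_simps[OF x M(1)]
  define \<beta> where "\<beta> = Im (x h)"
  assume "Im (x h) \<noteq> 0"
  then have \<beta>: "\<beta> \<noteq> 0" by (simp add: \<beta>_def)
  have bound: "\<beta>\<^sup>2 + 2 * \<beta> * t \<le> (norm h)\<^sup>2" for t :: real
  proof -
    define c where "c = \<i> * of_real t"
    have xv: "x (h + c *\<^sub>C 1) = x h + c"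
      using xs(1)[of h "c *\<^sub>C 1"] xs(2)[of 1 c] xs(4) cl(3)[of 1 c] h M by simp
    have "adj (h + c *\<^sub>C 1) * (h + c *\<^sub>C 1) = h * h + (c * cnj c) *\<^sub>C 1"
      unfolding adj_mult_self_add_scaleC
      using scaleC_add_left[of c "cnj c" h] by (simp add: h c_def add.assoc)
    then have "(norm (h + c *\<^sub>C 1))\<^sup>2 = norm (h * h + (c * cnj c) *\<^sub>C 1)"
      by (metis cstar_identity)
    also have "\<dots> \<le> (norm h)\<^sup>2 + t\<^sup>2"
    proof (rule norm_triangle_le, rule add_mono)
      show "norm (h * h) \<le> (norm h)\<^sup>2"
        by (simp add: power2_eq_square norm_mult_ineq)
      show "norm ((c * cnj c) *\<^sub>C (1::'a)) \<le> t\<^sup>2"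
        by (simp add: norm_scaleC c_def norm_mult power2_eq_square)
    qed
    finally have "(norm (h + c *\<^sub>C 1))\<^sup>2 \<le> (norm h)\<^sup>2 + t\<^sup>2" .
    moreover have "(cmod (x h + c))\<^sup>2 \<le> (norm (h + c *\<^sub>C 1))\<^sup>2"
    proof (rule power_mono)
      have "h + c *\<^sub>C 1 \<in> M" using cl(2)[of h "c *\<^sub>C 1"] cl(3)[of 1 c] h M by simp
      then show "cmod (x h + c) \<le> norm (h + c *\<^sub>C 1)"
        using character_norm_le[OF x M, of "h + c *\<^sub>C 1"] xv by simp
    qed simp
    moreover have "(\<beta> + t)\<^sup>2 \<le> (cmod (x h + c))\<^sup>2"
      by (simp add: cmod_power2 c_def \<beta>_def)
    ultimately have "(\<beta> + t)\<^sup>2 \<le> (norm h)\<^sup>2 + t\<^sup>2" by linarith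
    then show ?thesis by (simp add: power2_sum)
  qed
  have "2 * \<beta> * (((norm h)\<^sup>2 + 1) / (2 * \<beta>)) = (norm h)\<^sup>2 + 1"
    using \<beta> by simp
  then show False
    using bound[of "((norm h)\<^sup>2 + 1) / (2 * \<beta>)"] zero_le_power2[of \<beta>] by linarith
qed

lemma character_adj:
  assumes x: "x \<in> gelfand_space M" and M: "cstar_subalgebra M" "1 \<in> M" and h: "h \<in> M"
  shows "x (adj h) = cnj (x h)"
proof -
  note cl = cstar_subalgebra_closed[OF M(1)] and xs = gelfand_space_simps[OF x M(1)]
  have "Im (x (h + adj h)) = 0"
    by (rule character_self_adjoint_real[OF x M]) (use h cl in \<open>simp_all add: adj_add adj_adj add.commute\<close>)
  moreover have "Im (x (\<i> *\<^sub>C h + adj (\<i> *\<^sub>C h))) = 0"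
    by (rule character_self_adjoint_real[OF x M]) (use h cl in \<open>simp_all add: adj_add adj_adj add.commute\<close>)
  ultimately show ?thesis
    using h cl xs by (simp add: adj_scaleC complex_eq_iff)
qed

section \<open>States that extend a character\<close>

lemma character_expectation_state:
  assumes x: "x \<in> gelfand_space M" and M: "cstar_subalgebra M" "1 \<in> M"
    and E: "conditional_expectation M E"
  shows "is_state (\<lambda>a. x (E a))" and "h \<in> M \<Longrightarrow> x (E h) = x h"
proof -
  note cl = cstar_subalgebra_closed[OF M(1)] and xs = gelfand_space_simps[OF x M(1)]
  have EM: "E a \<in> M" for a using E by (auto simp: conditional_expectation_def)
  show Eh: "x (E h) = x h" if "h \<in> M" for h
    using E that by (simp add: conditional_expectation_def)
  have "clinear_on UNIV E" using E by (simp add: conditional_expectation_def)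
  then have "clinear_on UNIV (\<lambda>a. x (E a))"
    using EM xs by (simp add: clinear_on_def scaleC_complex_def)
  moreover have "0 \<le> x (E (adj a * a))" for a
  proof -
    have "E (adj a * a) \<in> positive_elements M"
      using E unfolding conditional_expectation_def positive_elements_def by blast
    then obtain b where b: "b \<in> M" "E (adj a * a) = adj b * b"
      by (auto simp: positive_elements_def)
    then have "x (E (adj a * a)) = cnj (x b) * x b"
      using cl xs character_adj[OF x M] by simp
    then show ?thesis by (simp add: less_eq_complex_def)
  qed
  ultimately show "is_state (\<lambda>a. x (E a))"
    using Eh[of 1] M xs(4) by (simp add: is_state_iff positive_functional_def)
qed

text \<open>
  The element \<open>k = h - x h\<close> of \<open>M\<close> satisfies \<open>\<phi> (adj k * k) = \<bar>x k\<bar>\<^sup>2 = 0\<close>, so \<open>\<phi>\<close> vanishes on all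
  multiples of \<open>k\<close>.
\<close>

lemma state_extending_character_mult:
  assumes \<phi>: "is_state \<phi>" and ext: "\<forall>h\<in>M. \<phi> h = x h"
    and x: "x \<in> gelfand_space M" and M: "cstar_subalgebra M" "1 \<in> M" and h: "h \<in> M"
  shows "\<phi> (a * h) = \<phi> a * x h" "\<phi> (h * a) = x h * \<phi> a"
proof -
  note cl = cstar_subalgebra_closed[OF M(1)] and xs = gelfand_space_simps[OF x M(1)]
  have pos: "positive_functional \<phi>" using \<phi> by (simp add: is_state_iff)
  note [simp] = positive_functional_simps[OF pos]
  have right: "\<phi> (a * h) = \<phi> a * x h" if h: "h \<in> M" for a h
  proof -
    define k where "k = h + (- x h) *\<^sub>C 1"
    have c1: "(- x h) *\<^sub>C 1 \<in> M" using cl(3)[OF M(2)] .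
    have k: "k \<in> M" using h c1 cl(2) by (simp add: k_def)
    have "x k = 0"
      using xs(1)[OF h c1] xs(2)[OF M(2), of "- x h"] xs(4)[OF M(2)] by (simp add: k_def)
    then have "\<phi> (adj k * k) = 0"
      using ext cl xs k by simp
    then have "\<phi> (a * k) = 0" by (rule positive_functional_mult_eq_0[OF pos])
    then show ?thesis
      by (simp add: k_def distrib_left mult_scaleC_right mult.commute)
  qed
  show "\<phi> (a * h) = \<phi> a * x h" by (rule right[OF h])
  have "\<phi> (adj a * adj h) = \<phi> (adj a) * x (adj h)" by (rule right[OF cl(5)[OF h]])
  then have "\<phi> (adj (h * a)) = cnj (x h * \<phi> a)"
    using character_adj[OF x M h] positive_functional_hermitian[OF pos, of a]
    by (simp add: adj_mult mult.commute)
  then show "\<phi> (h * a) = x h * \<phi> a"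
    using positive_functional_hermitian[OF pos, of "h * a"] by (metis complex_cnj_cnj)
qed

section \<open>The partial homeomorphism of a normalizer\<close>

lemma normalizer_gram_mem:
  assumes "n \<in> normalizers M" "1 \<in> M"
  shows "adj n * n \<in> M" "n * adj n \<in> M"
  using assms by (force simp: normalizers_def)+

text \<open>
  The only candidate for the image point is the quotient of the two values. It is
  multiplicative because \<open>n * adj n\<close> lies in the commutative algebra \<open>M\<close>:
  \<open>(adj n * h * n) * (adj n * k * n) = (adj n * (h * k) * n) * (adj n * n)\<close>.
\<close>

lemma alpha_apply:
  assumes M: "abelian_cstar_subalgebra M" "1 \<in> M" and n: "n \<in> normalizers M"
    and x: "x \<in> gelfand_space M" and nz: "x (adj n * n) \<noteq> 0"
  shows "alpha M n x = (\<lambda>h\<in>M. x (adj n * h * n) / x (adj n * n))"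
  unfolding alpha_def
proof (rule the_equality)
  have cs: "cstar_subalgebra M" and comm: "\<And>a b. a \<in> M \<Longrightarrow> b \<in> M \<Longrightarrow> a * b = b * a"
    using M by (auto simp: abelian_cstar_subalgebra_def)
  note cl = cstar_subalgebra_closed[OF cs] and xs = gelfand_space_simps[OF x cs]
  note gram = normalizer_gram_mem[OF n M(2)]
  have nhn: "adj n * h * n \<in> M" if "h \<in> M" for h using n that by (simp add: normalizers_def)
  let ?y = "\<lambda>h\<in>M. x (adj n * h * n) / x (adj n * n)"
  have "?y (h + k) = ?y h + ?y k" if "h \<in> M" "k \<in> M" for h k
  proof -
    have "adj n * (h + k) * n = adj n * h * n + adj n * k * n" by (simp add: algebra_simps)
    then show ?thesis using that cl xs nhn by (simp add: add_divide_distrib)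
  qed
  moreover have "?y (c *\<^sub>C h) = c * ?y h" if "h \<in> M" for h c
    using that cl xs nhn by (simp add: mult_scaleC_left mult_scaleC_right)
  moreover have "?y (h * k) = ?y h * ?y k" if h: "h \<in> M" and k: "k \<in> M" for h k
  proof -
    have "(adj n * h * n) * (adj n * k * n) = adj n * h * ((n * adj n) * k) * n"
      by (simp add: mult.assoc)
    also have "\<dots> = adj n * h * (k * (n * adj n)) * n"
      using comm[OF gram(2) k] by simp
    also have "\<dots> = (adj n * (h * k) * n) * (adj n * n)"
      by (simp add: mult.assoc)
    finally have "x ((adj n * h * n) * (adj n * k * n)) = x ((adj n * (h * k) * n) * (adj n * n))"
      by simp
    then have "x (adj n * h * n) * x (adj n * k * n) = x (adj n * (h * k) * n) * x (adj n * n)"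
      using xs(3)[OF nhn[OF h] nhn[OF k]] xs(3)[OF nhn[OF cl(4)[OF h k]] gram(1)] by simp
    then show ?thesis using h k cl nz by (simp add: field_simps)
  qed
  moreover have "?y 1 \<noteq> 0" using M(2) nz by simp
  ultimately have "?y \<in> gelfand_space M"
    unfolding gelfand_space_def clinear_on_def scaleC_complex_def using M(2) by blast
  then show "?y \<in> gelfand_space M \<and> (\<forall>h\<in>M. x (adj n * h * n) = ?y h * x (adj n * n))"
    using nz by simp
  fix y assume y: "y \<in> gelfand_space M \<and> (\<forall>h\<in>M. x (adj n * h * n) = y h * x (adj n * n))"
  show "y = ?y"
  proof (rule extensionalityI)
    show "y \<in> extensional M" using y by (simp add: gelfand_space_def)
    show "?y \<in> extensional M" by simp
    fix h assume "h \<in> M"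
    then show "y h = ?y h" using y nz by simp
  qed
qed

section \<open>A second state at a point of non-trivial isotropy\<close>

text \<open>
  With \<open>\<psi> = x \<circ> E\<close>, the functional \<open>\<theta> c\<close> below is the vector state of \<open>(1 + c n) \<Omega>\<close> in the GNS
  representation of \<open>\<psi>\<close>. On \<open>M\<close> the mixed terms vanish because \<open>\<psi> n = 0\<close>, and the last term
  is a multiple of \<open>x\<close> because \<open>n\<close> fixes \<open>x\<close>. At \<open>n\<close> itself only
  \<open>c \<psi> (n * n) + cnj c \<psi> (adj n * n)\<close> survives, with \<open>\<psi> (adj n * n) \<noteq> 0\<close>, and replacing \<open>c = 1\<close>
  by \<open>c = \<i>\<close> changes the relative sign of the two summands.
\<close>

lemma nontrivial_isotropy_second_state:
  assumes M: "abelian_cstar_subalgebra M" "1 \<in> M"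
    and E: "conditional_expectation M E" and x: "x \<in> gelfand_space M"
    and iso: "nontrivial_isotropy M E x"
  obtains \<phi> where "is_state \<phi>" "\<forall>h\<in>M. \<phi> h = x h" "\<phi> \<noteq> (\<lambda>a. x (E a))"
proof -
  have cs: "cstar_subalgebra M" using M by (simp add: abelian_cstar_subalgebra_def)
  obtain n where n: "n \<in> normalizers M" and dom: "0 < x (adj n * n)"
    and fix_x: "alpha M n x = x" and En: "x (E n) = 0"
    using iso by (auto simp: nontrivial_isotropy_def alpha_dom_def)
  define r where "r = Re (x (adj n * n))"
  have r: "0 < r" "x (adj n * n) = of_real r"
    using dom by (simp_all add: r_def less_complex_def complex_eq_iff)
  define \<psi> where "\<psi> a = x (E a)" for a
  have \<psi>: "is_state \<psi>" and ext: "\<forall>h\<in>M. \<psi> h = x h"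
    using character_expectation_state[OF x cs M(2) E] unfolding \<psi>_def by blast+
  have pos: "positive_functional \<psi>" using \<psi> by (simp add: is_state_iff)
  note ps = positive_functional_simps[OF pos]
  note mult = state_extending_character_mult[OF \<psi> ext x cs M(2)]
  have \<psi>n: "\<psi> n = 0" "\<psi> (adj n) = 0"
    using En positive_functional_hermitian[OF pos, of n] by (simp_all add: \<psi>_def)
  have gram: "adj n * n \<in> M" by (rule normalizer_gram_mem[OF n M(2)])
  have fixed: "x (adj n * h * n) = x h * of_real r" if "h \<in> M" for h
  proof -
    have "x (adj n * n) \<noteq> 0" using r by simp
    note alpha_apply[OF M n x this]
    then have "x h = x (adj n * h * n) / x (adj n * n)"
      using fix_x that by (simp add: fun_eq_iff)
    then show ?thesis using r by simp
  qed
  define \<theta> where "\<theta> c a = \<psi> (adj (1 + c *\<^sub>C n) * a * (1 + c *\<^sub>C n)) / of_real (1 + r)"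
    for c :: complex and a
  have nz: "complex_of_real (1 + r) \<noteq> 0"
    using r by (metis of_real_eq_0_iff add_pos_pos less_irrefl zero_less_one)
  have expand: "\<theta> c a * of_real (1 + r) =
      \<psi> a + c * \<psi> (a * n) + cnj c * \<psi> (adj n * a) + c * cnj c * \<psi> (adj n * a * n)" for c a
  proof -
    have "adj (1 + c *\<^sub>C n) * a * (1 + c *\<^sub>C n) =
        a + c *\<^sub>C (a * n) + cnj c *\<^sub>C (adj n * a) + (c * cnj c) *\<^sub>C (adj n * a * n)"
      by (simp add: adj_add adj_scaleC distrib_left distrib_right mult_scaleC_left mult_scaleC_right
          scaleC_scaleC scaleC_add_right mult.assoc mult.commute[of c] add_ac)
    then show ?thesis using nz by (simp add: \<theta>_def ps)
  qed
  have \<theta>_ext: "\<theta> c h = x h" if c: "c * cnj c = 1" and h: "h \<in> M" for c h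
  proof -
    have "adj n * h * n \<in> M" using n h by (simp add: normalizers_def)
    then have "\<theta> c h * of_real (1 + r) = x h * of_real (1 + r)"
      unfolding expand
      using c h \<psi>n fixed ext mult by (simp add: algebra_simps)
    then show ?thesis using nz by simp
  qed
  have \<theta>_state: "is_state (\<theta> c)" if c: "c * cnj c = 1" for c
  proof -
    have "clinear_on UNIV (\<theta> c)"
      unfolding clinear_on_def \<theta>_def
      by (simp add: distrib_left distrib_right ps add_divide_distrib mult_scaleC_left
          mult_scaleC_right scaleC_complex_def)
    moreover have "0 \<le> \<theta> c (adj a * a)" for a
    proof -
      have "0 \<le> \<psi> (adj (a * (1 + c *\<^sub>C n)) * (a * (1 + c *\<^sub>C n)))"
        by (rule positive_functional_nonneg[OF pos])
      then show ?thesis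
        using r by (simp add: \<theta>_def adj_mult mult.assoc less_eq_complex_def del: of_real_add)
    qed
    moreover have "\<theta> c 1 = 1"
      using \<theta>_ext[OF c M(2)] gelfand_space_simps(4)[OF x cs M(2)] by simp
    ultimately show ?thesis by (simp add: is_state_iff positive_functional_def)
  qed
  have \<theta>_n: "\<theta> c n * of_real (1 + r) = c * \<psi> (n * n) + cnj c * of_real r" for c
  proof -
    have "\<psi> (adj n * n * n) = 0" using mult(2)[OF gram, of n] \<psi>n by simp
    then show ?thesis unfolding expand using \<psi>n bspec[OF ext gram] r by simp
  qed
  have "\<theta> 1 n \<noteq> 0 \<or> \<theta> \<i> n \<noteq> 0"
  proof (rule ccontr)
    assume "\<not> ?thesis"
    then have "\<psi> (n * n) + of_real r = 0" "\<i> * \<psi> (n * n) - \<i> * of_real r = 0"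
      using \<theta>_n[of 1] \<theta>_n[of \<i>] by simp_all
    then have "complex_of_real r = 0" by (simp add: complex_eq_iff)
    then show False using r by simp
  qed
  then obtain c where c: "c * cnj c = 1" "\<theta> c n \<noteq> 0"
  proof
    assume "\<theta> 1 n \<noteq> 0"
    show thesis by (rule that[of 1]) (simp, fact)
  next
    assume "\<theta> \<i> n \<noteq> 0"
    show thesis by (rule that[of \<i>]) (simp, fact)
  qed
  show thesis
  proof (rule that)
    show "is_state (\<theta> c)" by (rule \<theta>_state[OF c(1)])
    show "\<forall>h\<in>M. \<theta> c h = x h" using \<theta>_ext[OF c(1)] by blast
    show "\<theta> c \<noteq> (\<lambda>a. x (E a))" using c(2) En by metis
  qed
qed

section \<open>Maximal abelian subalgebras\<close>

definition commutant :: "'a::times set \<Rightarrow> 'a set" where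
  "commutant S = {a. \<forall>b\<in>S. a * b = b * a}"

lemma cstar_subalgebra_commutant:
  fixes S :: "'a::unital_cstar_algebra set"
  assumes "adj ` S \<subseteq> S"
  shows "cstar_subalgebra (commutant S)"
proof -
  have "closed {a. a * b = b * a}" for b :: 'a
    by (intro closed_Collect_eq continuous_intros)
  moreover have "commutant S = (\<Inter>b\<in>S. {a. a * b = b * a})"
    by (auto simp: commutant_def)
  ultimately have "closed (commutant S)" by auto
  moreover have "adj a \<in> commutant S" if a: "a \<in> commutant S" for a
    unfolding commutant_def
  proof (rule CollectI, rule ballI)
    fix b assume "b \<in> S"
    then have "a * adj b = adj b * a" using a assms by (auto simp: commutant_def)
    then have "adj (a * adj b) = adj (adj b * a)" by simp
    then show "adj a * b = b * adj a" by (simp add: adj_mult adj_adj)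
  qed
  moreover have "a * b \<in> commutant S" if "a \<in> commutant S" "b \<in> commutant S" for a b
    unfolding commutant_def
  proof (rule CollectI, rule ballI)
    fix c assume "c \<in> S"
    then have "a * c = c * a" "b * c = c * b" using that by (simp_all add: commutant_def)
    then show "a * b * c = c * (a * b)" by (metis mult.assoc)
  qed
  ultimately show ?thesis
    unfolding cstar_subalgebra_def
    by (simp add: commutant_def distrib_left distrib_right mult_scaleC_left mult_scaleC_right)
qed

lemma maximal_abelian_imp_abelian: "maximal_abelian M \<Longrightarrow> abelian_cstar_subalgebra M"
  unfolding maximal_abelian_def by (elim conjE)

text \<open>
  A self-adjoint \<open>b\<close> that commutes with \<open>M\<close> lies in an abelian C*-subalgebra containing \<open>M\<close>. The
  bicommutant of \<open>S = insert b M\<close> serves as this algebra: it is closed, it contains \<open>S\<close>, and it is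
  abelian because \<open>S\<close> is contained in its own commutant. General elements are combinations of two
  self-adjoint ones.
\<close>

lemma maximal_abelian_commutant_subset:
  fixes M :: "'a::unital_cstar_algebra set"
  assumes M: "maximal_abelian M"
  shows "commutant M \<subseteq> M"
proof -
  have abM: "abelian_cstar_subalgebra M" by (rule maximal_abelian_imp_abelian[OF M])
  then have cs: "cstar_subalgebra M" and comm: "\<And>a b. a \<in> M \<Longrightarrow> b \<in> M \<Longrightarrow> a * b = b * a"
    by (auto simp: abelian_cstar_subalgebra_def)
  note cl = cstar_subalgebra_closed[OF cs]
  have sa: "b \<in> M" if b: "b \<in> commutant M" "adj b = b" for b
  proof -
    define S where "S = insert b M"
    have adjS: "adj ` S \<subseteq> S" using b cl by (auto simp: S_def)
    have "S \<subseteq> commutant S"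
      using b comm by (auto simp: S_def commutant_def)
    then have sub: "S \<subseteq> commutant (commutant S)" "commutant (commutant S) \<subseteq> commutant S"
      by (auto simp: commutant_def)
    have cs1: "cstar_subalgebra (commutant S)" by (rule cstar_subalgebra_commutant[OF adjS])
    then have "cstar_subalgebra (commutant (commutant S))"
      using cstar_subalgebra_commutant[of "commutant S"] cstar_subalgebra_closed(5)[OF cs1] by blast
    moreover have "a * c = c * a"
      if "a \<in> commutant (commutant S)" "c \<in> commutant (commutant S)" for a c
      using that sub(2) unfolding commutant_def by blast
    ultimately have "abelian_cstar_subalgebra (commutant (commutant S))"
      by (simp add: abelian_cstar_subalgebra_def)
    then have "commutant (commutant S) = M"
      using M sub(1) by (simp add: maximal_abelian_def S_def)
    then show "b \<in> M" using sub(1) by (auto simp: S_def)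
  qed
  show ?thesis
  proof
    fix w assume w: "w \<in> commutant M"
    have "cstar_subalgebra (commutant M)"
      using cl(5) by (intro cstar_subalgebra_commutant) auto
    note ccl = cstar_subalgebra_closed[OF this]
    have re: "w + adj w \<in> M"
      by (rule sa) (use w ccl in \<open>simp_all add: adj_add adj_adj add.commute\<close>)
    have im: "\<i> *\<^sub>C (w - adj w) \<in> M"
      by (rule sa) (use w ccl in \<open>simp_all add: adj_diff adj_adj adj_scaleC scaleC_diff_right
          scaleC_minus_left\<close>)
    have "(- \<i>) *\<^sub>C (\<i> *\<^sub>C (w - adj w)) = w - adj w"
      by (simp add: scaleC_scaleC)
    then have "w - adj w \<in> M" using cl(3)[OF im, of "- \<i>"] by simp
    then have "(w + adj w) + (w - adj w) \<in> M" using re cl by blast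
    moreover have "(w + adj w) + (w - adj w) = 2 *\<^sub>C w"
      using scaleC_add_left[of 1 1 w] by simp
    ultimately have "(1/2) *\<^sub>C (2 *\<^sub>C w) \<in> M" using cl(3) by simp
    then show "w \<in> M" by (simp add: scaleC_scaleC)
  qed
qed

text \<open>
  Applying \<open>E\<close> to \<open>h * n * (adj n * n) = n * (adj n * h * n)\<close> gives
  \<open>e * (adj n * h * n) = e * (h * (adj n * n))\<close> for \<open>e = E n\<close>: where \<open>e\<close> does not vanish, conjugation
  by \<open>n\<close> acts on \<open>M\<close> like multiplication by \<open>adj n * n\<close>. This makes \<open>v * adj e\<close> vanish for the
  commutator \<open>v = h * n - n * h\<close>, by the C*-identity, since all four terms of
  \<open>e * (adj v * v)\<close> agree up to sign. Therefore \<open>n * adj e\<close> commutes with \<open>M\<close>.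
\<close>

lemma normalizer_mult_adj_expectation_mem:
  assumes M: "maximal_abelian M" "1 \<in> M" and E: "conditional_expectation M E"
    and n: "n \<in> normalizers M"
  shows "n * adj (E n) \<in> M"
proof -
  have "abelian_cstar_subalgebra M" by (rule maximal_abelian_imp_abelian[OF M(1)])
  then have cs: "cstar_subalgebra M" and comm: "\<And>a b. a \<in> M \<Longrightarrow> b \<in> M \<Longrightarrow> a * b = b * a"
    by (auto simp: abelian_cstar_subalgebra_def)
  note cl = cstar_subalgebra_closed[OF cs] and gram = normalizer_gram_mem[OF n M(2)]
  define e where "e = E n"
  have e: "e \<in> M" using E by (auto simp: e_def conditional_expectation_def)
  have nhn: "adj n * h * n \<in> M" if "h \<in> M" for h using n that by (simp add: normalizers_def)
  have bimod: "E (h * a * k) = h * E a * k" if "h \<in> M" "k \<in> M" for h a k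
    using E that by (simp add: conditional_expectation_def)
  have key: "e * (adj n * h * n) = e * (h * (adj n * n))" if h: "h \<in> M" for h
  proof -
    have "h * n * (adj n * n) = h * (n * adj n) * n" by (simp add: mult.assoc)
    also have "\<dots> = (n * adj n) * h * n" using comm[OF h gram(2)] by simp
    also have "\<dots> = 1 * n * (adj n * h * n)" by (simp add: mult.assoc)
    finally have "E (h * n * (adj n * n)) = E (1 * n * (adj n * h * n))" by simp
    then have "h * e * (adj n * n) = e * (adj n * h * n)"
      using bimod[OF h gram(1)] bimod[OF M(2) nhn[OF h]] by (simp add: e_def)
    then show ?thesis using comm[OF h e] by (simp add: mult.assoc[symmetric])
  qed
  have "n * adj e \<in> commutant M"
    unfolding commutant_def
  proof (rule CollectI, rule ballI)
    fix h assume h: "h \<in> M"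
    define v where "v = h * n - n * h"
    have adjh: "adj h \<in> M" by (rule cl(5)[OF h])
    define g where "g = adj n * n"
    have g: "g \<in> M" using gram by (simp add: g_def)
    have keys: "e * (adj n * (adj h * h) * n) = e * (adj h * h * g)"
      "e * (adj n * adj h * n) = e * (adj h * g)"
      "e * (adj n * h * n) = e * (h * g)"
      unfolding g_def by (rule key[OF cl(4)[OF adjh h]] key[OF adjh] key[OF h])+
    have "e * (adj v * v) = e * (adj n * (adj h * h) * n) - e * (adj n * adj h * n) * h
        - (e * adj h) * (adj n * h * n) + e * adj h * g * h"
      by (simp add: v_def g_def adj_diff adj_mult left_diff_distrib right_diff_distrib mult.assoc)
    also have "(e * adj h) * (adj n * h * n) = adj h * (e * (adj n * h * n))"
      using comm[OF e adjh] by (simp add: mult.assoc)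
    also have "e * (adj n * (adj h * h) * n) - e * (adj n * adj h * n) * h
        - adj h * (e * (adj n * h * n)) + e * adj h * g * h =
        e * (adj h * (h * g)) - e * (adj h * (g * h)) - (adj h * e) * (h * g) + e * (adj h * (g * h))"
      unfolding keys by (simp add: mult.assoc)
    also have "\<dots> = 0"
      using comm[OF adjh e] comm[OF h g] by (simp add: mult.assoc)
    finally have "e * (adj v * v) = 0" .
    then have "adj (v * adj e) * (v * adj e) = 0"
      by (simp add: adj_mult adj_adj mult.assoc[symmetric])
    then have "v * adj e = 0" by (simp add: adj_mult_self_eq_0_iff)
    then have "h * n * adj e = n * (h * adj e)" by (simp add: v_def algebra_simps)
    then show "n * adj e * h = h * (n * adj e)"
      using comm[OF h cl(5)[OF e]] by (simp add: mult.assoc)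
  qed
  then show ?thesis
    using maximal_abelian_commutant_subset[OF M(1)] by (auto simp: e_def)
qed

section \<open>Uniqueness at points of trivial isotropy\<close>

text \<open>
  If \<open>x (E n) \<noteq> 0\<close>, both sides agree after multiplication by \<open>adj (E n)\<close>, as \<open>n * adj (E n)\<close> lies in
  \<open>M\<close> and is therefore its own expectation \<open>E n * adj (E n)\<close>. If \<open>x (E n) = 0\<close>, trivial isotropy
  says that \<open>n\<close> is undefined at \<open>x\<close> or moves \<open>x\<close>, and then \<open>\<phi> n = 0\<close>.
\<close>

lemma extension_at_normalizer:
  assumes M: "maximal_abelian M" "1 \<in> M" and E: "conditional_expectation M E"
    and x: "x \<in> gelfand_space M" and triv: "trivial_isotropy M E x"
    and \<phi>: "is_state \<phi>" and ext: "\<forall>h\<in>M. \<phi> h = x h"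
    and n: "n \<in> normalizers M"
  shows "\<phi> n = x (E n)"
proof -
  have abM: "abelian_cstar_subalgebra M" by (rule maximal_abelian_imp_abelian[OF M(1)])
  then have cs: "cstar_subalgebra M" and comm: "\<And>a b. a \<in> M \<Longrightarrow> b \<in> M \<Longrightarrow> a * b = b * a"
    by (auto simp: abelian_cstar_subalgebra_def)
  note cl = cstar_subalgebra_closed[OF cs] and gram = normalizer_gram_mem[OF n M(2)]
  have pos: "positive_functional \<phi>" using \<phi> by (simp add: is_state_iff)
  note mult = state_extending_character_mult[OF \<phi> ext x cs M(2)]
  have e: "E n \<in> M" using E by (auto simp: conditional_expectation_def)
  have nhn: "adj n * h * n \<in> M" if "h \<in> M" for h using n that by (simp add: normalizers_def)
  show ?thesis
  proof (cases "x (E n) = 0")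
    case False
    have ne: "n * adj (E n) \<in> M"
      by (rule normalizer_mult_adj_expectation_mem[OF M E n])
    have "n * adj (E n) = E (1 * n * adj (E n))"
      using E ne by (simp add: conditional_expectation_def)
    also have "\<dots> = 1 * E n * adj (E n)"
      using E M(2) cl(5)[OF e] unfolding conditional_expectation_def by blast
    finally have "\<phi> (n * adj (E n)) = \<phi> (E n * adj (E n))" by simp
    then have "\<phi> n * x (adj (E n)) = x (E n) * x (adj (E n))"
      using mult(1)[OF cl(5)[OF e]] bspec[OF ext e] by simp
    then show ?thesis using False character_adj[OF x cs M(2) e] by simp
  next
    case True
    have "\<phi> n = 0"
    proof (cases "x (adj n * n) = 0")
      case True
      then show ?thesis
        using positive_functional_mult_eq_0(2)[OF pos, of n 1] bspec[OF ext gram(1)] by simp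
    next
      case False
      have "0 \<le> x (adj n * n)"
        using positive_functional_nonneg[OF pos, of n] bspec[OF ext gram(1)] by simp
      with False have "x \<in> alpha_dom M n" using x by (simp add: alpha_dom_def order_less_le)
      then have moved: "alpha M n x \<noteq> x"
        using triv n True by (auto simp: nontrivial_isotropy_def)
      have "\<exists>h\<in>M. x (adj n * h * n) / x (adj n * n) \<noteq> x h"
      proof (rule ccontr)
        assume "\<not> ?thesis"
        then have "alpha M n x = restrict x M"
          unfolding alpha_apply[OF abM M(2) n x False] by (intro restrict_ext) blast
        also have "\<dots> = x" using x by (simp add: gelfand_space_def extensional_restrict)
        finally show False using moved by blast
      qed
      then obtain h where h: "h \<in> M" "x (adj n * h * n) / x (adj n * n) \<noteq> x h" by blast
      have "h * (n * (adj n * n)) = h * (n * adj n) * n" by (simp add: mult.assoc)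
      also have "\<dots> = (n * adj n) * h * n" using comm[OF h(1) gram(2)] by simp
      also have "\<dots> = n * (adj n * h * n)" by (simp add: mult.assoc)
      finally have "\<phi> (h * (n * (adj n * n))) = \<phi> (n * (adj n * h * n))" by simp
      then have "x h * (\<phi> n * x (adj n * n)) = \<phi> n * x (adj n * h * n)"
        using mult(2)[OF h(1)] mult(1)[OF gram(1)] mult(1)[OF nhn[OF h(1)]] by simp
      then have "\<phi> n * (x h * x (adj n * n) - x (adj n * h * n)) = 0"
        by (simp add: algebra_simps)
      then show ?thesis using h(2) False by (simp add: field_simps)
    qed
    then show ?thesis using True by simp
  qed
qed

section \<open>Density of the span of the normalizers\<close>

lemma normalizers_mult:
  assumes "a \<in> normalizers M" "b \<in> normalizers M" "a * b \<noteq> 0"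
  shows "a * b \<in> normalizers M"
proof -
  have eq: "adj (a * b) * h * (a * b) = adj b * (adj a * h * a) * b"
    "(a * b) * h * adj (a * b) = a * (b * h * adj b) * adj a" for h
    by (simp_all add: adj_mult mult.assoc)
  have "adj (a * b) * h * (a * b) \<in> M" "(a * b) * h * adj (a * b) \<in> M" if "h \<in> M" for h
    unfolding eq using assms that by (simp_all add: normalizers_def)
  then show ?thesis using assms(3) by (simp add: normalizers_def)
qed

lemma normalizers_adj:
  assumes "a \<in> normalizers M"
  shows "adj a \<in> normalizers M"
proof -
  have "adj a \<noteq> 0" using assms norm_adj[of a] by (auto simp: normalizers_def)
  then show ?thesis using assms by (simp add: normalizers_def adj_adj)
qed

lemma normalizers_scaleC:
  assumes "cstar_subalgebra M" "a \<in> normalizers M" "c \<noteq> 0"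
  shows "c *\<^sub>C a \<in> normalizers M"
proof -
  have "c *\<^sub>C a \<noteq> 0"
    using assms norm_scaleC[of c a] by (auto simp: normalizers_def)
  then show ?thesis
    using assms(2) cstar_subalgebra_closed(3)[OF assms(1)]
    by (simp add: normalizers_def adj_scaleC mult_scaleC_left mult_scaleC_right)
qed

lemma cstar_subalgebra_closure:
  fixes S :: "'a::unital_cstar_algebra set"
  assumes "0 \<in> S" "\<And>a b. a \<in> S \<Longrightarrow> b \<in> S \<Longrightarrow> a + b \<in> S" "\<And>c a. a \<in> S \<Longrightarrow> c *\<^sub>C a \<in> S"
    "\<And>a b. a \<in> S \<Longrightarrow> b \<in> S \<Longrightarrow> a * b \<in> S" "\<And>a. a \<in> S \<Longrightarrow> adj a \<in> S"
  shows "cstar_subalgebra (closure S)"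
proof -
  have bin: "f a b \<in> closure S"
    if ab: "a \<in> closure S" "b \<in> closure S" and f: "\<And>a b. a \<in> S \<Longrightarrow> b \<in> S \<Longrightarrow> f a b \<in> S"
      and lim: "\<And>u v. u \<longlonglongrightarrow> a \<Longrightarrow> v \<longlonglongrightarrow> b \<Longrightarrow> (\<lambda>i. f (u i) (v i)) \<longlonglongrightarrow> f a b"
    for f a b
  proof -
    obtain u v where "\<And>i. u i \<in> S" "u \<longlonglongrightarrow> a" "\<And>i. v i \<in> S" "v \<longlonglongrightarrow> b"
      using ab unfolding closure_sequential by blast
    then show ?thesis
      unfolding closure_sequential using f lim[of u v]
      by (intro exI[of _ "\<lambda>i. f (u i) (v i)"]) simp
  qed
  have "a + b \<in> closure S" "a * b \<in> closure S" if "a \<in> closure S" "b \<in> closure S" for a b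
    by (rule bin[OF that]; use assms in \<open>auto intro: tendsto_add tendsto_mult\<close>)+
  moreover have "adj a \<in> closure S" "c *\<^sub>C a \<in> closure S" if "a \<in> closure S" for a c
    by (rule bin[OF that that]; use assms in \<open>auto intro: bounded_linear.tendsto[OF bounded_linear_adj]
        bounded_linear.tendsto[OF bounded_linear_scaleC]\<close>)+
  moreover have "0 \<in> closure S" using assms(1) closure_subset by blast
  ultimately show ?thesis by (simp add: cstar_subalgebra_def)
qed

text \<open>
  Products, adjoints and complex multiples of normalizers are normalizers or zero, so their real
  span is already a *-subalgebra over the complex numbers.
\<close>

lemma closure_span_normalizers:
  fixes M :: "'a::unital_cstar_algebra set"
  assumes M: "cstar_subalgebra M" and gen: "cstar_subalgebra hull normalizers M = UNIV"
  shows "closure (span (normalizers M)) = UNIV"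
proof -
  let ?S = "span (normalizers M)"
  have sc: "c *\<^sub>C a \<in> ?S" if "a \<in> ?S" for c a
    using that
  proof (induction rule: span_induct_alt)
    case (step r a b)
    have "c *\<^sub>C a \<in> ?S"
      using normalizers_scaleC[OF M step(1), of c] span_base[of _ "normalizers M"] span_zero
      by (cases "c = 0") auto
    moreover have "c *\<^sub>C (r *\<^sub>R a + b) = r *\<^sub>R (c *\<^sub>C a) + c *\<^sub>C b"
      by (simp add: scaleC_add_right scaleC_of_real[symmetric] scaleC_scaleC mult.commute)
    ultimately show ?case using step(2) by (simp add: span_add span_scale)
  qed (simp add: span_zero)
  have adj: "adj a \<in> ?S" if "a \<in> ?S" for a
    using that
  proof (induction rule: span_induct_alt)
    case (step r a b)
    then show ?case
      by (simp add: adj_add adj_scaleR span_add span_scale span_base normalizers_adj)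
  qed (simp add: span_zero)
  have mult: "a * b \<in> ?S" if a: "a \<in> ?S" and b: "b \<in> ?S" for a b
    using a
  proof (induction rule: span_induct_alt)
    case (step r m c)
    have "m * b \<in> ?S"
      using b
    proof (induction rule: span_induct_alt)
      case (step s k d)
      have "m * k \<in> ?S"
        using normalizers_mult[OF \<open>m \<in> normalizers M\<close> step(1)] span_base[of _ "normalizers M"]
          span_zero[of "normalizers M"] by (cases "m * k = 0") auto
      then show ?case using step(2) by (simp add: distrib_left span_add span_scale)
    qed (simp add: span_zero)
    then show ?case using step(2) by (simp add: distrib_right span_add span_scale)
  qed (simp add: span_zero)
  have "cstar_subalgebra (closure ?S)"
    by (rule cstar_subalgebra_closure) (simp_all add: span_zero span_add sc adj mult)
  moreover have "normalizers M \<subseteq> closure ?S"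
    using span_superset closure_subset by blast
  ultimately have "cstar_subalgebra hull normalizers M \<subseteq> closure ?S"
    by (intro hull_minimal)
  then show ?thesis unfolding gen by blast
qed

lemma states_eq_if_eq_on_normalizers:
  assumes M: "cstar_subalgebra M" and gen: "cstar_subalgebra hull normalizers M = UNIV"
    and "is_state \<phi>" "is_state \<psi>" and eq: "\<And>n. n \<in> normalizers M \<Longrightarrow> \<phi> n = \<psi> n"
  shows "\<phi> = \<psi>"
proof
  fix a
  have bl: "bounded_linear \<phi>" "bounded_linear \<psi>" using assms by (simp_all add: state_bounded_linear)
  have span: "\<phi> b = \<psi> b" if "b \<in> span (normalizers M)" for b
    using bl eq that by (metis bounded_linear.linear linear_eq_on)
  have "closed {b. \<phi> b = \<psi> b}"
    using bl by (intro closed_Collect_eq linear_continuous_on)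
  moreover have "span (normalizers M) \<subseteq> {b. \<phi> b = \<psi> b}" using span by blast
  ultimately have "closure (span (normalizers M)) \<subseteq> {b. \<phi> b = \<psi> b}"
    by (rule closure_minimal[rotated])
  then show "\<phi> a = \<psi> a" using closure_span_normalizers[OF M gen] by auto
qed

section \<open>Unique extension and isotropy\<close>

theorem corollary3:
  fixes M :: "'a::unital_cstar_algebra set"
    and E :: "'a \<Rightarrow> 'a"
    and x\<^sub>0 :: "'a \<Rightarrow> complex"
  assumes "cartan_pair M"
    and "faithful_conditional_expectation M E"
    and "x\<^sub>0 \<in> gelfand_space M"
  shows "(\<exists>!\<phi>. is_state \<phi> \<and> (\<forall>f\<in>M. \<phi> f = x\<^sub>0 f)) \<longleftrightarrow> trivial_isotropy M E x\<^sub>0"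
proof -
  have M: "maximal_abelian M" "1 \<in> M" and gen: "cstar_subalgebra hull normalizers M = UNIV"
    using assms(1) unfolding cartan_pair_def by blast+
  have E: "conditional_expectation M E"
    using assms(2) by (simp add: faithful_conditional_expectation_def)
  have ab: "abelian_cstar_subalgebra M" by (rule maximal_abelian_imp_abelian[OF M(1)])
  then have cs: "cstar_subalgebra M" by (simp add: abelian_cstar_subalgebra_def)
  note \<psi> = character_expectation_state[OF assms(3) cs M(2) E]
  show ?thesis
  proof
    assume unique: "\<exists>!\<phi>. is_state \<phi> \<and> (\<forall>f\<in>M. \<phi> f = x\<^sub>0 f)"
    show "trivial_isotropy M E x\<^sub>0"
    proof
      assume "nontrivial_isotropy M E x\<^sub>0"
      then obtain \<phi> where "is_state \<phi>" "\<forall>h\<in>M. \<phi> h = x\<^sub>0 h" "\<phi> \<noteq> (\<lambda>a. x\<^sub>0 (E a))"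
        using nontrivial_isotropy_second_state[OF ab M(2) E assms(3)] by blast
      then show False using unique \<psi> by blast
    qed
  next
    assume triv: "trivial_isotropy M E x\<^sub>0"
    show "\<exists>!\<phi>. is_state \<phi> \<and> (\<forall>f\<in>M. \<phi> f = x\<^sub>0 f)"
    proof (rule ex1I)
      show "is_state (\<lambda>a. x\<^sub>0 (E a)) \<and> (\<forall>f\<in>M. x\<^sub>0 (E f) = x\<^sub>0 f)" using \<psi> by blast
      fix \<phi> assume "is_state \<phi> \<and> (\<forall>f\<in>M. \<phi> f = x\<^sub>0 f)"
      then show "\<phi> = (\<lambda>a. x\<^sub>0 (E a))"
        using extension_at_normalizer[OF M E assms(3) triv, of \<phi>] \<psi>(1)
        by (intro states_eq_if_eq_on_normalizers[OF cs gen]) auto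
    qed
  qed
qed

end
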